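(* For every integer $r\geq 1$ (and $q\in\mathbb{C}$ with $|q|<1$), $$\sum_{n\geq 0}\Big(o_1^{(r)}(n)-o_3^{(r)}(n)\Big)q^n=\frac{f_r f_{4r}}{f_1 f_{2r}}.$$
   Context: For a positive integer $k$ and complex $q$ with $|q|<1$, $f_k:=(q^k;q^k)_\infty=\prod_{i\geq 1}(1-q^{ki})$. $\mathcal{P}(n)$ is the set of all partitions of $n$ (for $n=0$, only the empty partition). For an integer $r\geq 1$ and a partition $\pi$, $r\text{-}\mathrm{mex}(\pi)$ (the least $r$-gap) is the least positive integer that does not occur at least $r$ times as a part of $\pi$. $o_1^{(r)}(n)$ (respectively $o_3^{(r)}(n)$) denotes the number of $\pi\in\mathcal{P}(n)$ with $r\text{-}\mathrm{mex}(\pi)\equiv 1 \pmod 4$ (respectively $\equiv 3\pmod 4$). *)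

theory Defs
  imports Complex_Main "HOL-Library.Multiset" "HOL-Analysis.Infinite_Products"
begin

text \<open>A partition of \<open>n\<close> is the multiset of its (positive) parts.\<close>

definition partitions :: "nat \<Rightarrow> nat multiset set" where
  "partitions n = {\<pi>. (\<forall>p \<in># \<pi>. p > 0) \<and> sum_mset \<pi> = n}"

text \<open>For \<open>r \<ge> 1\<close> the minimum exists, because a multiset has only finitely many distinct elements.\<close>

definition mex :: "nat \<Rightarrow> nat multiset \<Rightarrow> nat" where
  "mex r \<pi> = (LEAST m. m > 0 \<and> \<not> count \<pi> m \<ge> r)"

definition o1 :: "nat \<Rightarrow> nat \<Rightarrow> nat" where
  "o1 r n = card {\<pi> \<in> partitions n. mex r \<pi> mod 4 = 1}"

definition o3 :: "nat \<Rightarrow> nat \<Rightarrow> nat" where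
  "o3 r n = card {\<pi> \<in> partitions n. mex r \<pi> mod 4 = 3}"

text \<open>The product \<open>f\<^sub>k = (q\<^sup>k; q\<^sup>k)\<^sub>\<infinity>\<close>, with the index shifted because \<open>prodinf\<close> starts at \<open>0\<close>.\<close>

definition euler_f :: "complex \<Rightarrow> nat \<Rightarrow> complex" where
  "euler_f q k = (\<Prod>i. 1 - q ^ (k * Suc i))"

end

theory Submission
  imports Defs "HOL-Analysis.Infinite_Sum"
begin

text \<open>The signs \<open>(-1)\<^bsup>m(m+1)/2\<^esup>\<close> run through \<open>+, -, -, +\<close> periodically, so their partial sums over \<open>m < M\<close>
  are \<open>1, 0, -1, 0\<close> for \<open>M \<equiv> 1, 2, 3, 0 (mod 4)\<close>. Hence the left-hand side is the sum of
  \<open>(-1)\<^bsup>m(m+1)/2\<^esup> q\<^bsup>|\<pi>|\<^esup>\<close> over all pairs with \<open>m\<close> below the \<open>r\<close>-mex of \<open>\<pi>\<close>, that is, with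
  each of \<open>1, \<dots>, m\<close> occurring at least \<open>r\<close> times in \<open>\<pi>\<close>. Removing \<open>r\<close> copies of each of these parts
  leaves an arbitrary partition, so the sum factors as \<open>1/f\<^sub>1\<close> times the sum of \<open>x\<^bsup>m(m+1)/2\<^esup>\<close> with
  \<open>x = -q\<^bsup>r\<^esup>\<close>. Gauss's identity evaluates the latter as the product of
  \<open>(1 - x\<^bsup>2k\<^esup>)/(1 - x\<^bsup>2k-1\<^esup>)\<close>, which equals \<open>f\<^sub>r f\<^bsub>4r\<^esub>/f\<^bsub>2r\<^esub>\<close>.\<close>

section \<open>Infinite sums and products\<close>

text \<open>A finite set whose supersets all have sums close to \<open>S\<close> already lies in
  some \<open>A N\<close>. For \<open>n >= N\<close> the finite sums inside \<open>A n\<close> that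
  contain it are close to \<open>S\<close>, and closeness passes to their limit
  \<open>s n\<close>.\<close>

lemma has_sum_incseq_tendsto:
  fixes f :: "'a \<Rightarrow> 'b :: {comm_monoid_add, metric_space}"
  assumes mono: "incseq A"
    and S: "(f has_sum S) (\<Union>n. A n)"
    and s: "\<And>n. (f has_sum s n) (A n)"
  shows "s \<longlonglongrightarrow> S"
proof (rule metric_LIMSEQ_I)
  fix e :: real assume "e > 0"
  \<comment> \<open>The limit \<open>s n\<close> inherits only a weak inequality, so half of
    \<open>e\<close> is used to get a strict one at the end.\<close>
  then have "e / 2 > 0" by simp
  then have "\<forall>\<^sub>F X in finite_subsets_at_top (\<Union>n. A n). dist (sum f X) S < e / 2"
    by (rule tendstoD[OF S[unfolded has_sum_def]])
  then obtain X where X: "finite X" "X \<subseteq> (\<Union>n. A n)"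
    and close: "\<forall>Y. finite Y \<and> X \<subseteq> Y \<and> Y \<subseteq> (\<Union>n. A n) \<longrightarrow> dist (sum f Y) S < e / 2"
    unfolding eventually_finite_subsets_at_top by (elim exE conjE) (rule that)
  obtain k where k: "\<And>x. x \<in> X \<Longrightarrow> x \<in> A (k x)"
    using X(2) bchoice[of X "\<lambda>x k. x \<in> A k"] by blast
  define N where "N = Max (insert 0 (k ` X))"
  have "k x \<le> N" if "x \<in> X" for x
    using X(1) that by (simp add: N_def)
  then have N: "X \<subseteq> A N"
    using k incseqD[OF mono] by blast
  have "dist (s n) S < e" if "n \<ge> N" for n
  proof -
    have "X \<subseteq> A n"
      using N incseqD[OF mono that] by blast
    then have "\<forall>\<^sub>F Y in finite_subsets_at_top (A n). dist (sum f Y) S \<le> e / 2"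
      unfolding eventually_finite_subsets_at_top
    proof (intro exI[of _ X] conjI allI impI)
      fix Y assume "finite Y \<and> X \<subseteq> Y \<and> Y \<subseteq> A n"
      with close show "dist (sum f Y) S \<le> e / 2"
        by (intro less_imp_le) blast
    qed (use X in auto)
    moreover have "((\<lambda>Y. dist (sum f Y) S) \<longlongrightarrow> dist (s n) S) (finite_subsets_at_top (A n))"
      using s[of n] unfolding has_sum_def by (intro tendsto_intros)
    ultimately have "dist (s n) S \<le> e / 2"
      by (intro tendsto_upperbound) auto
    with \<open>e > 0\<close> show ?thesis by simp
  qed
  then show "\<exists>N. \<forall>n\<ge>N. dist (s n) S < e" by blast
qed

lemma abs_summable_on_Times_mult:
  fixes f :: "'a \<Rightarrow> 'c :: {real_normed_field, banach}"
  assumes "f abs_summable_on A" and "g abs_summable_on B"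
  shows "(\<lambda>(x, y). f x * g y) abs_summable_on A \<times> B"
proof -
  have "(\<lambda>x. norm (f x) * (\<Sum>\<^sub>\<infinity>y\<in>B. norm (g y))) summable_on A"
    using assms(1) by (rule summable_on_cmult_left)
  then show ?thesis
    using assms(2)
    by (intro abs_summable_on_Sigma_iff[THEN iffD2])
       (auto simp: norm_mult infsum_cmult_right' infsum_nonneg abs_mult intro: summable_on_cmult_right)
qed

lemma has_sum_Times_mult:
  fixes f :: "'a \<Rightarrow> 'c :: {real_normed_field, banach}"
  assumes "f abs_summable_on A" and "g abs_summable_on B"
    and "(f has_sum s) A" and "(g has_sum t) B"
  shows "((\<lambda>(x, y). f x * g y) has_sum s * t) (A \<times> B)"
proof (rule has_sum_SigmaI)
  show "((\<lambda>y. case (x, y) of (x, y) \<Rightarrow> f x * g y) has_sum f x * t) B" for x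
    using assms(4) by (simp add: has_sum_cmult_right)
  show "((\<lambda>x. f x * t) has_sum s * t) A"
    using assms(3) by (rule has_sum_cmult_left)
  show "(\<lambda>(x, y). f x * g y) summable_on A \<times> B"
    using abs_summable_on_Times_mult[OF assms(1,2)] by (rule abs_summable_summable)
qed

section \<open>Convergence and nonvanishing of the products\<close>

lemma norm_power_less_1:
  fixes q :: "'a :: real_normed_div_algebra"
  assumes "norm q < 1" and "n > 0"
  shows "norm (q ^ n) < 1"
  using assms by (simp add: norm_power power_less_one_iff)

lemma one_minus_power_neq_0:
  fixes q :: "'a :: real_normed_field"
  assumes "norm q < 1" and "n > 0"
  shows "1 - q ^ n \<noteq> 0"
  using norm_power_less_1[OF assms] by auto

lemma one_plus_power_neq_0:
  fixes q :: "'a :: real_normed_field"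
  assumes "norm q < 1" and "n > 0"
  shows "1 + q ^ n \<noteq> 0"
  using norm_power_less_1[OF assms] by (auto simp: add_eq_0_iff)

lemma convergent_prod_one_minus_power:
  fixes q :: "'a :: {real_normed_field, banach, heine_borel}"
  assumes "norm q < 1"
  shows "convergent_prod (\<lambda>i. 1 - q ^ Suc i)"
proof -
  have "summable (\<lambda>i. norm q ^ Suc i)"
    using assms by (subst summable_Suc_iff) (auto intro: summable_geometric)
  then show ?thesis
    by (intro abs_convergent_prod_imp_convergent_prod summable_imp_abs_convergent_prod)
       (simp add: norm_mult norm_power)
qed

lemma prod_one_minus_power_tendsto:
  fixes q :: "'a :: {real_normed_field, banach, heine_borel}"
  assumes "norm q < 1"
  shows "(\<lambda>n. \<Prod>i<n. 1 - q ^ Suc i) \<longlonglongrightarrow> (\<Prod>i. 1 - q ^ Suc i)"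
  using convergent_prod_LIMSEQ[OF convergent_prod_one_minus_power[OF assms]]
  by (subst filterlim_sequentially_Suc[symmetric]) (simp add: lessThan_Suc_atMost del: power_Suc)

lemma prodinf_one_minus_power_neq_0:
  fixes q :: "'a :: {real_normed_field, banach, heine_borel}"
  assumes "norm q < 1"
  shows "(\<Prod>i. 1 - q ^ Suc i) \<noteq> 0"
  using prodinf_nonzero[OF convergent_prod_one_minus_power[OF assms]]
    one_minus_power_neq_0[OF assms] by blast

lemma euler_f_eq: "euler_f q k = (\<Prod>i. 1 - (q ^ k) ^ Suc i)"
  by (simp only: euler_f_def power_mult)

section \<open>Gauss's triangular number identity\<close>

text \<open>The quotient of q-Pochhammer symbols \<open>(x^2; x^2)_n / (x; x^2)_n\<close>, a partial
  product of the product side of Gauss's identity.\<close>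

definition gauss_prod :: "'a :: field \<Rightarrow> nat \<Rightarrow> 'a" where
  "gauss_prod x n = (\<Prod>k<n. (1 - x ^ (2 * k + 2)) / (1 - x ^ (2 * k + 1)))"

lemma gauss_prod_neq_0:
  fixes x :: "'a :: real_normed_field"
  assumes "norm x < 1"
  shows "gauss_prod x n \<noteq> 0"
  using one_minus_power_neq_0[OF assms]
  by (auto simp only: gauss_prod_def prod_zero_iff finite_lessThan divide_eq_0_iff)

lemma Suc_triangular: "Suc n * (Suc n + 1) div 2 = n * (n + 1) div 2 + Suc n" for n :: nat
proof -
  have "Suc n * (Suc n + 1) = n * (n + 1) + Suc n * 2" by (simp add: algebra_simps)
  then show ?thesis by simp
qed

lemma double_triangular: "(2 * n) * (2 * n + 1) div 2 = n * (2 * n + 1)" for n :: nat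
  by simp

text \<open>Shanks's finite form of the identity. Passing from \<open>n\<close> to \<open>n + 1\<close> changes the summands on the
  right by differences of consecutive values of \<open>g\<close> below, up to the two new triangular powers.\<close>

lemma triangular_sum_finite:
  fixes x :: "'a :: real_normed_field"
  assumes "norm x < 1"
  shows "(\<Sum>m<2 * n. x ^ (m * (m + 1) div 2)) =
    (\<Sum>s<n. gauss_prod x n / gauss_prod x s * x ^ (s * (2 * n + 1)))"
proof (induction n)
  case 0
  then show ?case by simp
next
  case (Suc n)
  define P where "P = gauss_prod x"
  define d where "d = 1 - x ^ (2 * n + 1)"
  \<comment> \<open>The factor \<open>1 - x ^ (2 * s)\<close> makes \<open>g 0 = 0\<close>, and in
    \<open>g (Suc s)\<close> it cancels against the numerator of the last factor of
    \<open>P (Suc s)\<close>.\<close>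
  define g where "g s = P n / P s * x ^ (s * (2 * n + 1)) * (1 - x ^ (2 * s)) / d" for s
  have P0: "P s \<noteq> 0" for s
    using gauss_prod_neq_0[OF assms] by (simp add: P_def)
  have d0: "d \<noteq> 0"
    using one_minus_power_neq_0[OF assms, of "2 * n + 1"] by (simp add: d_def)
  have Pn: "P (Suc n) = P n * (1 - x ^ (2 * n + 2)) / d"
    by (simp add: P_def gauss_prod_def d_def)
  have step: "P (Suc n) / P s * x ^ (s * (2 * Suc n + 1)) =
      P n / P s * x ^ (s * (2 * n + 1)) + (g (Suc s) - g s)" for s
  proof -
    define y where "y = x ^ (s * (2 * n + 1))"
    have s0: "1 - x ^ (2 * s + 1) \<noteq> 0"
      using one_minus_power_neq_0[OF assms, of "2 * s + 1"] by simp
    have s2: "1 - x ^ (2 * s + 2) \<noteq> 0"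
      using one_minus_power_neq_0[OF assms, of "2 * s + 2"] by simp
    have Ps: "P (Suc s) = P s * (1 - x ^ (2 * s + 2)) / (1 - x ^ (2 * s + 1))"
      by (simp add: P_def gauss_prod_def)
    have gs: "g (Suc s) = P n / P s * y * x ^ (2 * n + 1) * (1 - x ^ (2 * s + 1)) / d"
      unfolding g_def Ps y_def using s0 s2 P0[of s] d0
      by (simp add: power_add[symmetric] divide_simps) (simp add: algebra_simps power_add)
    have y': "x ^ (s * (2 * Suc n + 1)) = y * x ^ (2 * s)"
      by (simp add: y_def power_add[symmetric] algebra_simps)
    \<comment> \<open>Multiplied by \<open>P n / P s * y / d\<close>, this polynomial identity is
      the claimed step: the left side gives the new summand, \<open>d\<close> the old one, and the
      bracket the difference of \<open>g\<close>.\<close>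
    have "(1 - x ^ (2 * n + 2)) * x ^ (2 * s) =
        d + (x ^ (2 * n + 1) * (1 - x ^ (2 * s + 1)) - (1 - x ^ (2 * s)))"
      by (simp add: d_def algebra_simps power_add[symmetric])
    then have "P n / P s * y / d * ((1 - x ^ (2 * n + 2)) * x ^ (2 * s)) =
        P n / P s * y / d * (d + (x ^ (2 * n + 1) * (1 - x ^ (2 * s + 1)) - (1 - x ^ (2 * s))))"
      by simp
    then show ?thesis
      unfolding gs y' Pn g_def[of s] y_def[symmetric] using d0
      by (simp add: algebra_simps add_divide_distrib diff_divide_distrib)
  qed
  have "(\<Sum>s<n. P (Suc n) / P s * x ^ (s * (2 * Suc n + 1))) =
      (\<Sum>s<n. P n / P s * x ^ (s * (2 * n + 1))) + g n"
    unfolding step sum.distrib sum_lessThan_telescope by (simp add: g_def)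
  also have "(\<Sum>s<n. P n / P s * x ^ (s * (2 * n + 1))) = (\<Sum>m<2 * n. x ^ (m * (m + 1) div 2))"
    using Suc.IH by (simp add: P_def)
  finally have A: "(\<Sum>s<Suc n. P (Suc n) / P s * x ^ (s * (2 * Suc n + 1))) =
      (\<Sum>m<2 * n. x ^ (m * (m + 1) div 2)) +
      (g n + P (Suc n) / P n * x ^ (n * (2 * Suc n + 1)))"
    by simp
  have gn: "g n = x ^ (n * (2 * n + 1)) * (1 - x ^ (2 * n)) / d"
    using P0[of n] by (simp add: g_def)
  have T: "P (Suc n) / P n * x ^ (n * (2 * Suc n + 1)) =
      (1 - x ^ (2 * n + 2)) / d * (x ^ (n * (2 * n + 1)) * x ^ (2 * n))"
  proof -
    have "x ^ (n * (2 * Suc n + 1)) = x ^ (n * (2 * n + 1)) * x ^ (2 * n)"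
      by (simp add: algebra_simps flip: power_add)
    then show ?thesis
      using P0[of n] by (simp add: Pn)
  qed
  \<comment> \<open>The boundary term \<open>g n\<close> and the new summand \<open>s = n\<close>
    have the common factor \<open>x ^ (n * (2 * n + 1)) / d\<close>. Their remaining factors add up
    to \<open>1 - x ^ (4 * n + 2)\<close>, so \<open>d\<close> cancels and the triangular powers
    with indices \<open>2 * n\<close> and \<open>2 * n + 1\<close> remain.\<close>
  have D: "(1 - x ^ (2 * n)) + (1 - x ^ (2 * n + 2)) * x ^ (2 * n) = d * (1 + x ^ (2 * n + 1))"
    by (simp add: d_def algebra_simps power_add[symmetric])
  have "y * A / d + B / d * (y * z) = y * (A + B * z) / d" for y A B z :: 'a
    by (simp add: add_divide_distrib distrib_left mult_ac)
  then have "g n + P (Suc n) / P n * x ^ (n * (2 * Suc n + 1)) =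
      x ^ (n * (2 * n + 1)) * (d * (1 + x ^ (2 * n + 1))) / d"
    unfolding gn T D[symmetric] .
  also have "\<dots> = x ^ (n * (2 * n + 1)) + x ^ (n * (2 * n + 1) + (2 * n + 1))"
    unfolding power_add[of x "n * (2 * n + 1)" "2 * n + 1"] using d0 by (simp add: field_simps)
  also have "\<dots> = x ^ ((2 * n) * (2 * n + 1) div 2) +
      x ^ (Suc (2 * n) * (Suc (2 * n) + 1) div 2)"
    unfolding Suc_triangular double_triangular by simp
  finally show ?case
    using A by (simp add: P_def)
qed

lemma triangular_powers_abs_summable:
  fixes x :: "'a :: {real_normed_field, banach}"
  assumes "norm x < 1"
  shows "(\<lambda>m::nat. x ^ (m * (m + 1) div 2)) abs_summable_on UNIV"
proof -
  have "(\<lambda>m. norm x ^ m) summable_on UNIV"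
    using assms by (intro norm_summable_imp_summable_on) (auto intro: summable_geometric)
  moreover have "m \<le> m * (m + 1) div 2" for m :: nat
    using Suc_triangular[of "m - 1"] by (cases m) simp_all
  ultimately show ?thesis
    using assms by (intro abs_summable_on_comparison_test')
      (auto simp: norm_power intro!: power_decreasing)
qed

text \<open>In the finite form the summand \<open>s = 0\<close> is the Gauss product itself, which
  tends to \<open>L\<close>. The other summands carry high powers of \<open>x\<close>, and their
  coefficients are bounded because the products and, by \<open>L \<noteq> 0\<close>, their inverses
  are bounded.\<close>

lemma triangular_sum:
  fixes x :: "'a :: {real_normed_field, banach}"
  assumes x: "norm x < 1" and L: "gauss_prod x \<longlonglongrightarrow> L" "L \<noteq> 0"
  shows "((\<lambda>m::nat. x ^ (m * (m + 1) div 2)) has_sum L) UNIV"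
proof -
  let ?f = "\<lambda>m::nat. x ^ (m * (m + 1) div 2)"
  let ?P = "gauss_prod x"
  have "Bseq ?P"
    by (rule convergent_imp_Bseq[OF convergentI[OF L(1)]])
  then obtain B where B: "B > 0" "\<forall>n. norm (?P n) \<le> B"
    by (rule BseqE)
  have "(\<lambda>s. inverse (?P s)) \<longlonglongrightarrow> inverse L"
    using L by (rule tendsto_inverse)
  then have "Bseq (\<lambda>s. inverse (?P s))"
    by (rule convergent_imp_Bseq[OF convergentI])
  then obtain C where C: "C > 0" "\<forall>n. norm (inverse (?P n)) \<le> C"
    by (rule BseqE)
  define R where "R n = (\<Sum>s<Suc n. ?P (Suc n) / ?P s * x ^ (s * (2 * Suc n + 1))) - ?P (Suc n)" for n
  have R: "R n = (\<Sum>s<n. ?P (Suc n) / ?P (Suc s) * x ^ (Suc s * (2 * Suc n + 1)))" for n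
    unfolding R_def by (subst sum.lessThan_Suc_shift) (simp add: gauss_prod_def)
  have "norm (R n) \<le> B * C / (1 - norm x) * norm x ^ n" for n
  proof -
    have "norm (R n) \<le> (\<Sum>s<n. B * C * norm x ^ n * norm x ^ s)"
      unfolding R
    proof (intro order.trans[OF norm_sum] sum_mono)
      fix s assume "s \<in> {..<n}"
      \<comment> \<open>This crude bound on the exponent separates decay in \<open>n\<close> from a
        geometric series in \<open>s\<close>.\<close>
      have "n + s \<le> Suc s * (2 * Suc n + 1)"
        by simp
      then have "norm x ^ (Suc s * (2 * Suc n + 1)) \<le> norm x ^ (n + s)"
        using x by (intro power_decreasing) auto
      then have "norm (?P (Suc n)) * norm (inverse (?P (Suc s))) * norm x ^ (Suc s * (2 * Suc n + 1))
          \<le> B * C * norm x ^ (n + s)"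
        using B C by (intro mult_mono) auto
      then show "norm (?P (Suc n) / ?P (Suc s) * x ^ (Suc s * (2 * Suc n + 1)))
          \<le> B * C * norm x ^ n * norm x ^ s"
        by (simp only: norm_mult norm_power power_add divide_inverse mult.assoc)
    qed
    also have "\<dots> = B * C * norm x ^ n * (\<Sum>s<n. norm x ^ s)"
      by (simp add: sum_distrib_left)
    also have "(\<Sum>s<n. norm x ^ s) \<le> 1 / (1 - norm x)"
      using x sum_le_suminf[OF summable_geometric, of "norm x" "{..<n}"]
      by (simp add: suminf_geometric)
    finally show ?thesis
      using B C by (simp add: mult_left_mono)
  qed
  moreover have "(\<lambda>n. B * C / (1 - norm x) * norm x ^ n) \<longlonglongrightarrow> 0"
    using x by (intro tendsto_mult_right_zero LIMSEQ_power_zero) simp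
  ultimately have "R \<longlonglongrightarrow> 0"
    by (intro Lim_null_comparison[of R]) auto
  then have "(\<lambda>n. R n + ?P (Suc n)) \<longlonglongrightarrow> 0 + L"
    using LIMSEQ_Suc[OF L(1)] by (rule tendsto_add)
  then have lim: "(\<lambda>n. sum ?f {..<2 * Suc n}) \<longlonglongrightarrow> L"
    unfolding triangular_sum_finite[OF x] R_def by simp
  \<comment> \<open>The finite form controls only partial sums of even length. Since the whole
    series is summable, this subsequence determines its value.\<close>
  have "(?f has_sum infsum ?f UNIV) UNIV"
    by (rule has_sum_infsum[OF abs_summable_summable[OF triangular_powers_abs_summable[OF x]]])
  then have "(\<lambda>n. sum ?f {..<n}) \<longlonglongrightarrow> infsum ?f UNIV"
    unfolding sums_def[symmetric] by (rule has_sum_imp_sums)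
  then have "(\<lambda>n. sum ?f {..<2 * Suc n}) \<longlonglongrightarrow> infsum ?f UNIV"
    by (rule filterlim_compose) (auto intro!: filterlim_subseq simp: strict_mono_def)
  with lim have "infsum ?f UNIV = L"
    by (rule LIMSEQ_unique[symmetric])
  with \<open>(?f has_sum infsum ?f UNIV) UNIV\<close> show ?thesis by simp
qed

lemma prod_lessThan_double: "(\<Prod>i<2 * n. f i) = (\<Prod>k<n. f (2 * k) * f (2 * k + 1))"
  for f :: "nat \<Rightarrow> 'a :: comm_monoid_mult"
proof (induction n)
  case 0
  show ?case by simp
next
  case (Suc n)
  have "(\<Prod>i<2 * Suc n. f i) = (\<Prod>i<2 * n. f i) * (f (2 * n) * f (2 * n + 1))"
    by (simp add: mult.assoc)
  with Suc show ?case by simp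
qed

text \<open>At \<open>x = - a\<close> the denominators become \<open>1 + a ^ (2 * k + 1)\<close>, a
  quotient of \<open>1 - a ^ (4 * k + 2)\<close> by \<open>1 - a ^ (2 * k + 1)\<close>. Cutting the
  products for \<open>a\<close> and \<open>a ^ 2\<close> at \<open>2 * n\<close> and the one for
  \<open>a ^ 4\<close> at \<open>n\<close> makes the identity exact for every
  \<open>n\<close>.\<close>

lemma gauss_prod_minus_tendsto:
  fixes a :: complex
  assumes a: "norm a < 1"
  shows "gauss_prod (- a) \<longlonglongrightarrow> euler_f a 1 * euler_f a 4 / euler_f a 2"
proof -
  define F where "F = (\<lambda>k n. \<Prod>i<n. 1 - (a ^ k) ^ Suc i)"
  have F: "F k \<longlonglongrightarrow> euler_f a k" if "k > 0" for k
    unfolding F_def euler_f_eq by (rule prod_one_minus_power_tendsto[OF norm_power_less_1[OF a that]])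
  have F': "(\<lambda>n. F k (2 * n)) \<longlonglongrightarrow> euler_f a k" if "k > 0" for k
    by (rule filterlim_compose[OF F[OF that]]) (auto intro!: filterlim_subseq simp: strict_mono_def)
  have "gauss_prod (- a) = (\<lambda>n. F 1 (2 * n) * F 4 n / F 2 (2 * n))"
  proof
    fix n
    have exps: "1 * Suc (2 * k) = 2 * k + 1" "1 * Suc (2 * k + 1) = 2 * k + 2"
      "2 * Suc (2 * k) = 4 * k + 2" "2 * Suc (2 * k + 1) = 4 * k + 4" "4 * Suc k = 4 * k + 4" for k :: nat
      by simp_all
    have F1: "F 1 (2 * n) = (\<Prod>k<n. (1 - a ^ (2 * k + 1)) * (1 - a ^ (2 * k + 2)))"
      and F2: "F 2 (2 * n) = (\<Prod>k<n. (1 - a ^ (4 * k + 2)) * (1 - a ^ (4 * k + 4)))"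
      and F4: "F 4 n = (\<Prod>k<n. 1 - a ^ (4 * k + 4))"
      by (simp_all only: F_def prod_lessThan_double power_mult[symmetric] exps)
    \<comment> \<open>The factor \<open>1 - a ^ (4 * k + 4)\<close> is inserted above and below:
      below it completes \<open>F 2\<close>, above it forms \<open>F 4\<close>.\<close>
    have eq: "(1 - (- a) ^ (2 * k + 2)) / (1 - (- a) ^ (2 * k + 1)) =
        (1 - a ^ (2 * k + 1)) * (1 - a ^ (2 * k + 2)) * (1 - a ^ (4 * k + 4)) /
        ((1 - a ^ (4 * k + 2)) * (1 - a ^ (4 * k + 4)))" for k
    proof -
      have "1 + a ^ (2 * k + 1) \<noteq> 0" "1 - a ^ (2 * k + 1) \<noteq> 0" "1 - a ^ (4 * k + 4) \<noteq> 0"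
        using one_plus_power_neq_0[OF a, of "2 * k + 1"]
          one_minus_power_neq_0[OF a, of "2 * k + 1"] one_minus_power_neq_0[OF a, of "4 * k + 4"]
        by auto
      moreover have "1 - a ^ (4 * k + 2) = (1 - a ^ (2 * k + 1)) * (1 + a ^ (2 * k + 1))"
        by (simp add: algebra_simps flip: power_add)
      moreover have "(- a) ^ (2 * k + 2) = a ^ (2 * k + 2)" "(- a) ^ (2 * k + 1) = - (a ^ (2 * k + 1))"
        by simp_all
      ultimately show ?thesis by simp
    qed
    show "gauss_prod (- a) n = F 1 (2 * n) * F 4 n / F 2 (2 * n)"
      by (simp only: gauss_prod_def eq F1 F2 F4 prod.distrib prod_dividef)
  qed
  moreover have "(\<lambda>n. F 1 (2 * n) * F 4 n / F 2 (2 * n)) \<longlonglongrightarrow>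
      euler_f a 1 * euler_f a 4 / euler_f a 2"
    using prodinf_one_minus_power_neq_0[of "a ^ 2"] norm_power_less_1[OF a, of 2]
    by (intro tendsto_intros F F') (auto simp: euler_f_eq)
  ultimately show ?thesis
    by (simp only:)
qed

section \<open>The generating function of partitions\<close>

definition positive_parts :: "nat multiset set" where
  "positive_parts = {\<pi>. \<forall>p \<in># \<pi>. p > 0}"

definition bounded_parts :: "nat \<Rightarrow> nat multiset set" where
  "bounded_parts k = {\<pi>. set_mset \<pi> \<subseteq> {1..k}}"

lemma positive_parts_eq: "positive_parts = (\<Union>k. bounded_parts k)"
proof (intro subset_antisym subsetI)
  fix \<pi> assume "\<pi> \<in> positive_parts"
  then have "\<pi> \<in> bounded_parts (Max (set_mset \<pi>))"
    by (auto simp: positive_parts_def bounded_parts_def Suc_le_eq)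
  then show "\<pi> \<in> (\<Union>k. bounded_parts k)" by blast
qed (auto simp: positive_parts_def bounded_parts_def subset_iff)

lemma incseq_bounded_parts: "incseq bounded_parts"
  by (rule incseq_SucI) (auto simp: bounded_parts_def)

text \<open>Splitting off all copies of the largest admissible part makes their number
  \<open>j\<close> independent of the rest, which yields one geometric series per part size.\<close>

lemma bounded_parts_Suc_bij:
  "bij_betw (\<lambda>(j, \<pi>). replicate_mset j (Suc k) + \<pi>) (UNIV \<times> bounded_parts k) (bounded_parts (Suc k))"
proof (rule bij_betw_byWitness[where f' = "\<lambda>\<pi>. (count \<pi> (Suc k), filter_mset (\<lambda>p. p \<noteq> Suc k) \<pi>)"])
  show "\<forall>a\<in>UNIV \<times> bounded_parts k.
      (\<lambda>\<pi>. (count \<pi> (Suc k), filter_mset (\<lambda>p. p \<noteq> Suc k) \<pi>))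
        ((\<lambda>(j, \<pi>). replicate_mset j (Suc k) + \<pi>) a) = a"
    by (auto simp: bounded_parts_def multiset_eq_iff count_eq_zero_iff)
qed (auto simp: bounded_parts_def multiset_eq_iff subset_iff le_Suc_eq split: if_splits)

text \<open>Each new part size multiplies the sum by a geometric series. Absolute summability is
  carried through the induction because multiplying the two families requires it. The field is kept
  general so that the result applies both to complex \<open>q\<close> and to its real norm.\<close>

lemma bounded_parts_gf:
  fixes q :: "'a :: {real_normed_field, banach}"
  assumes q: "norm q < 1"
  shows "(\<lambda>\<pi>. q ^ sum_mset \<pi>) abs_summable_on bounded_parts k \<and>
    ((\<lambda>\<pi>. q ^ sum_mset \<pi>) has_sum inverse (\<Prod>i<k. 1 - q ^ Suc i)) (bounded_parts k)"
proof (induction k)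
  case 0
  have "bounded_parts 0 = {{#}}"
    by (auto simp: bounded_parts_def)
  then show ?case
    using has_sum_finite[of "{{#}}" "\<lambda>\<pi>. q ^ sum_mset \<pi>"] by simp
next
  case (Suc k)
  let ?c = "q ^ Suc k"
  have c: "norm ?c < 1"
    using norm_power_less_1[OF q] by blast
  have s: "summable (\<lambda>j. norm (?c ^ j))"
    using c by (simp add: norm_power summable_geometric del: power_Suc)
  have geo: "(\<lambda>j. ?c ^ j) abs_summable_on UNIV"
    using s by (intro norm_summable_imp_summable_on) simp
  have geo': "((\<lambda>j. ?c ^ j) has_sum inverse (1 - ?c)) UNIV"
    using geometric_sums[OF c] by (intro norm_summable_imp_has_sum s) (simp add: inverse_eq_divide)
  have eq: "(\<lambda>(j, \<pi>). ?c ^ j * q ^ sum_mset \<pi>) =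
      (\<lambda>x. q ^ sum_mset (case x of (j, \<pi>) \<Rightarrow> replicate_mset j (Suc k) + \<pi>))"
    by (auto simp: fun_eq_iff power_add power_mult mult.commute simp del: power_Suc
        simp flip: power_mult)
  have "(\<lambda>x. norm (q ^ sum_mset (case x of (j, \<pi>) \<Rightarrow> replicate_mset j (Suc k) + \<pi>)))
      summable_on UNIV \<times> bounded_parts k"
    using abs_summable_on_Times_mult[OF geo, of "\<lambda>\<pi>. q ^ sum_mset \<pi>" "bounded_parts k"] Suc
    unfolding eq by blast
  moreover have "((\<lambda>x. q ^ sum_mset (case x of (j, \<pi>) \<Rightarrow> replicate_mset j (Suc k) + \<pi>))
      has_sum inverse (1 - ?c) * inverse (\<Prod>i<k. 1 - q ^ Suc i)) (UNIV \<times> bounded_parts k)"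
    using has_sum_Times_mult[OF geo _ geo', of "\<lambda>\<pi>. q ^ sum_mset \<pi>" "bounded_parts k"] Suc
    unfolding eq by blast
  ultimately show ?case
    using summable_on_reindex_bij_betw[OF bounded_parts_Suc_bij, of "\<lambda>\<pi>. norm (q ^ sum_mset \<pi>)" k]
      has_sum_reindex_bij_betw[OF bounded_parts_Suc_bij, of "\<lambda>\<pi>. q ^ sum_mset \<pi>" k]
    by (simp add: mult.commute del: power_Suc)
qed

text \<open>Any finite set of partitions has bounded parts, so its sum of norms is at most a
  bounded-parts generating function at \<open>norm q\<close>. These values converge as the bound
  grows, hence have a common upper bound.\<close>

lemma positive_parts_abs_summable:
  fixes q :: complex
  assumes q: "norm q < 1"
  shows "(\<lambda>\<pi>. q ^ sum_mset \<pi>) abs_summable_on positive_parts"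
proof (rule nonneg_bdd_above_summable_on)
  define x where "x = norm q"
  have x: "norm x < 1"
    using q by (simp add: x_def)
  have "(\<lambda>k. inverse (\<Prod>i<k. 1 - x ^ Suc i)) \<longlonglongrightarrow> inverse (\<Prod>i. 1 - x ^ Suc i)"
    using x by (intro tendsto_inverse prod_one_minus_power_tendsto prodinf_one_minus_power_neq_0)
  then have "Bseq (\<lambda>k. inverse (\<Prod>i<k. 1 - x ^ Suc i))"
    by (rule convergent_imp_Bseq[OF convergentI])
  then obtain B where B: "\<forall>k. norm (inverse (\<Prod>i<k. 1 - x ^ Suc i)) \<le> B"
    by (rule BseqE)
  show "bdd_above (sum (\<lambda>\<pi>. norm (q ^ sum_mset \<pi>)) ` {F. F \<subseteq> positive_parts \<and> finite F})"
  proof (rule bdd_aboveI2)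
    fix F assume F: "F \<in> {F. F \<subseteq> positive_parts \<and> finite F}"
    \<comment> \<open>Inserting 0 gives the maximum a meaning when no part occurs at all.\<close>
    define k where "k = Max (insert 0 (\<Union>\<pi>\<in>F. set_mset \<pi>))"
    have "F \<subseteq> bounded_parts k"
    proof
      fix \<pi> assume \<pi>: "\<pi> \<in> F"
      with F have "\<pi> \<in> positive_parts" by blast
      with F \<pi> show "\<pi> \<in> bounded_parts k"
        by (auto simp: bounded_parts_def positive_parts_def k_def Suc_le_eq intro!: Max_ge)
    qed
    moreover have "((\<lambda>\<pi>. x ^ sum_mset \<pi>) has_sum inverse (\<Prod>i<k. 1 - x ^ Suc i)) (bounded_parts k)"
      using bounded_parts_gf[OF x] by blast
    ultimately have "sum (\<lambda>\<pi>. x ^ sum_mset \<pi>) F \<le> inverse (\<Prod>i<k. 1 - x ^ Suc i)"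
      using F by (intro has_sum_mono_neutral[OF has_sum_finite]) (auto simp: x_def)
    also have "\<dots> \<le> B"
      using B[rule_format, of k] unfolding real_norm_def by (rule abs_le_D1)
    finally show "sum (\<lambda>\<pi>. norm (q ^ sum_mset \<pi>)) F \<le> B"
      by (simp add: x_def norm_power)
  qed
qed simp

text \<open>The finite products are the sums over an increasing exhaustion by bounded parts, so they
  tend both to the full sum and to the inverse of the infinite product.\<close>

lemma positive_parts_gf:
  fixes q :: complex
  assumes q: "norm q < 1"
  shows "((\<lambda>\<pi>. q ^ sum_mset \<pi>) has_sum inverse (euler_f q 1)) positive_parts"
proof -
  let ?f = "\<lambda>\<pi>. q ^ sum_mset \<pi>"
  have S: "(?f has_sum infsum ?f positive_parts) positive_parts"
    by (rule has_sum_infsum[OF abs_summable_summable[OF positive_parts_abs_summable[OF q]]])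
  have "(\<lambda>k. inverse (\<Prod>i<k. 1 - q ^ Suc i)) \<longlonglongrightarrow> infsum ?f positive_parts"
    using S bounded_parts_gf[OF q]
    by (intro has_sum_incseq_tendsto[OF incseq_bounded_parts, of ?f]) (auto simp: positive_parts_eq)
  moreover have "(\<lambda>k. inverse (\<Prod>i<k. 1 - q ^ Suc i)) \<longlonglongrightarrow> inverse (\<Prod>i. 1 - q ^ Suc i)"
    using q by (intro tendsto_inverse prod_one_minus_power_tendsto prodinf_one_minus_power_neq_0)
  ultimately have "infsum ?f positive_parts = inverse (euler_f q 1)"
    unfolding euler_f_eq power_one_right by (rule LIMSEQ_unique)
  with S show ?thesis by simp
qed

lemma finite_partitions: "finite (partitions n)"
proof (rule finite_subset)
  show "partitions n \<subseteq> mset ` {xs. set xs \<subseteq> {..n} \<and> length xs \<le> n}"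
  proof
    fix \<pi> assume \<pi>: "\<pi> \<in> partitions n"
    obtain xs where xs: "\<pi> = mset xs"
      by (metis ex_mset)
    have pos: "\<forall>p\<in>set xs. p \<ge> 1" and n: "sum_list xs = n"
      using \<pi> by (auto simp: partitions_def xs sum_mset_sum_list Suc_le_eq)
    have "length xs \<le> sum_list xs"
      using pos by (induction xs) auto
    then show "\<pi> \<in> mset ` {xs. set xs \<subseteq> {..n} \<and> length xs \<le> n}"
      using n member_le_sum_list[of _ xs] by (auto simp: xs)
  qed
qed (intro finite_imageI finite_lists_length_le finite_atMost)

section \<open>The least gap\<close>

text \<open>The smallest multiset under inclusion in which each of \<open>1, ..., m\<close> occurs
  at least \<open>r\<close> times; it is the block removed from a partition.\<close>

definition staircase :: "nat \<Rightarrow> nat \<Rightarrow> nat multiset" where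
  "staircase r m = (\<Sum>i = 1..m. replicate_mset r i)"

lemma count_staircase: "count (staircase r m) p = (if p \<in> {1..m} then r else 0)"
  by (simp add: staircase_def count_sum)

lemma sum_mset_staircase: "sum_mset (staircase r m) = r * (m * (m + 1) div 2)"
proof (induction m)
  case 0
  then show ?case by (simp add: staircase_def)
next
  case (Suc m)
  have "staircase r (Suc m) = staircase r m + replicate_mset r (Suc m)"
    by (simp add: staircase_def)
  then have "sum_mset (staircase r (Suc m)) = r * (m * (m + 1) div 2 + Suc m)"
    using Suc by (simp add: distrib_left)
  then show ?case
    by (simp only: Suc_triangular)
qed

text \<open>The minimum exceeds \<open>m\<close> precisely when no number in \<open>1..m\<close>
  fails the multiplicity test. Stated as an inclusion, this is a condition that adding and
  subtracting multisets can handle.\<close>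

lemma less_mex_iff:
  assumes "r \<ge> 1"
  shows "m < mex r \<pi> \<longleftrightarrow> staircase r m \<subseteq># \<pi>"
proof -
  \<comment> \<open>Adding 0 to the multiset forces the fresh number \<open>p\<close> to be
    positive. Its count is 0, which is below \<open>r\<close>, so the minimum defining
    \<open>mex\<close> exists.\<close>
  obtain p where "p \<notin># \<pi> + {#0#}"
    using ex_new_if_finite[OF infinite_UNIV_nat finite_set_mset] by blast
  then have ex: "p > 0 \<and> \<not> count \<pi> p \<ge> r"
    using assms by (auto simp: count_eq_zero_iff[symmetric] split: if_splits)
  have "m < mex r \<pi> \<longleftrightarrow> (\<forall>i\<in>{1..m}. r \<le> count \<pi> i)"
  proof
    assume "m < mex r \<pi>"
    then have "\<not> (i > 0 \<and> \<not> r \<le> count \<pi> i)" if "i \<le> m" for i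
      unfolding mex_def using that by (intro not_less_Least) simp
    then show "\<forall>i\<in>{1..m}. r \<le> count \<pi> i" by fastforce
  next
    assume *: "\<forall>i\<in>{1..m}. r \<le> count \<pi> i"
    have "mex r \<pi> > 0 \<and> \<not> count \<pi> (mex r \<pi>) \<ge> r"
      unfolding mex_def using ex by (rule LeastI)
    with * show "m < mex r \<pi>"
      by (metis One_nat_def Suc_leI atLeastAtMost_iff linorder_not_less)
  qed
  then show ?thesis
    by (auto simp: subseteq_mset_def count_staircase)
qed

text \<open>A partition with a chosen \<open>m\<close> below its mex contains the staircase, so
  removing it loses nothing; conversely, adding the staircase to any partition pushes the mex beyond
  \<open>m\<close>.\<close>

lemma staircase_bij:
  assumes "r \<ge> 1"
  shows "bij_betw (\<lambda>(m, \<pi>). (\<pi> + staircase r m, m)) (UNIV \<times> positive_parts)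
    (Sigma positive_parts (\<lambda>\<pi>. {..<mex r \<pi>}))"
proof (rule bij_betw_byWitness[where f' = "\<lambda>(\<pi>, m). (m, \<pi> - staircase r m)"])
  have "p > 0" if "p \<in># staircase r m" for p m
    using that by (auto simp: count_greater_zero_iff[symmetric] count_staircase
        simp del: count_greater_zero_iff split: if_splits)
  then show "(\<lambda>(m, \<pi>). (\<pi> + staircase r m, m)) ` (UNIV \<times> positive_parts)
      \<subseteq> Sigma positive_parts (\<lambda>\<pi>. {..<mex r \<pi>})"
    by (auto simp: positive_parts_def less_mex_iff[OF assms])
  show "(\<lambda>(\<pi>, m). (m, \<pi> - staircase r m)) ` Sigma positive_parts (\<lambda>\<pi>. {..<mex r \<pi>})
      \<subseteq> UNIV \<times> positive_parts"
    by (auto simp: positive_parts_def dest: in_diffD)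
qed (auto simp: less_mex_iff[OF assms])

text \<open>The nonprincipal Dirichlet character modulo 4, with values in an arbitrary ring.\<close>

definition mod4_weight :: "nat \<Rightarrow> 'a :: ring_1" where
  "mod4_weight m = of_bool (m mod 4 = 1) - of_bool (m mod 4 = 3)"

lemma mod4_weight_eq_sum: "(\<Sum>k<m. (- 1) ^ (k * (k + 1) div 2)) = (mod4_weight m :: 'a :: ring_1)"
proof (induction m)
  case 0
  then show ?case by (simp add: mod4_weight_def)
next
  case (Suc m)
  obtain d e where m: "m = 4 * d + e" and e: "e < 4"
    by (metis mod_less_divisor mult_div_mod_eq zero_less_numeral)
  \<comment> \<open>The triangular numbers of \<open>m\<close> and of its residue \<open>e\<close>
    differ by an even number, so the sign depends on \<open>e\<close> alone and four cases
    suffice.\<close>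
  have T: "m * (m + 1) div 2 = 2 * (4 * d * d + 2 * d * e + d) + e * (e + 1) div 2"
  proof -
    have "m * (m + 1) = 2 * (2 * (4 * d * d + 2 * d * e + d)) + e * (e + 1)"
      by (simp add: m algebra_simps)
    then show ?thesis by simp
  qed
  have "(- 1 :: 'a) ^ (m * (m + 1) div 2) = (- 1) ^ (e * (e + 1) div 2)"
    unfolding T power_add power_mult by simp
  moreover from e consider "e = 0" | "e = 1" | "e = 2" | "e = 3" by linarith
  then have "mod4_weight m + (- 1 :: 'a) ^ (e * (e + 1) div 2) = mod4_weight (Suc m)"
    by cases (simp_all add: mod4_weight_def m mod_Suc)
  ultimately show ?case
    using Suc by simp
qed

lemma o1_minus_o3:
  "(\<Sum>\<pi>\<in>partitions n. mod4_weight (mex r \<pi>)) = (of_nat (o1 r n) - of_nat (o3 r n) :: 'a :: ring_1)"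
  using finite_partitions[of n]
  by (simp add: mod4_weight_def sum_subtractf o1_def o3_def of_bool_def sum.If_cases Int_def conj_commute)

section \<open>The double sum over partitions with a marked staircase\<close>

theorem theorem1p8:
  fixes r :: nat and q :: complex
  assumes "r \<ge> 1" and "norm q < 1"
  shows "(\<lambda>n. (of_nat (o1 r n) - of_nat (o3 r n)) * q ^ n) sums
           (euler_f q r * euler_f q (4 * r) / (euler_f q 1 * euler_f q (2 * r)))"
proof -
  define a where "a = q ^ r"
  define L where "L = euler_f a 1 * euler_f a 4 / euler_f a 2"
  define t :: "nat \<Rightarrow> nat" where "t m = m * (m + 1) div 2" for m
  have a: "norm a < 1"
    using norm_power_less_1[OF assms(2)] assms(1) by (simp add: a_def)
  \<comment> \<open>Gauss's identity is applied at \<open>- a\<close>; this turns its products in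
    \<open>a\<close> into products in \<open>q\<close> with indices multiplied by
    \<open>r\<close>.\<close>
  have euler_a: "euler_f a k = euler_f q (k * r)" for k
    by (simp add: euler_f_def a_def mult_ac del: mult_Suc_right flip: power_mult)
  have "euler_f a k \<noteq> 0" if "k > 0" for k
    unfolding euler_f_eq by (rule prodinf_one_minus_power_neq_0[OF norm_power_less_1[OF a that]])
  then have "L \<noteq> 0"
    by (simp add: L_def)
  then have L: "((\<lambda>m. (- a) ^ t m) has_sum L) UNIV"
    unfolding t_def using a gauss_prod_minus_tendsto[OF a] by (intro triangular_sum) (auto simp: L_def)
  \<comment> \<open>The power splits into the sign attached to \<open>m\<close> and \<open>q\<close>
    raised to the size of the staircase.\<close>
  have power_t: "(- a) ^ t m = (- 1) ^ t m * q ^ (r * t m)" for m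
    by (subst power_minus) (simp add: a_def power_mult)
  have "((\<lambda>(m, \<pi>). (- a) ^ t m * q ^ sum_mset \<pi>) has_sum L * inverse (euler_f q 1))
      (UNIV \<times> positive_parts)"
    using a positive_parts_abs_summable[OF assms(2)] positive_parts_gf[OF assms(2)] L
      triangular_powers_abs_summable[of "- a"]
    by (intro has_sum_Times_mult) (auto simp: t_def)
  \<comment> \<open>Sizes add when the staircase is joined to the partition, so the summand depends
    only on the image pair and can be transported along the bijection.\<close>
  also have "(\<lambda>(m, \<pi>). (- a) ^ t m * q ^ sum_mset \<pi>) =
      (\<lambda>x. case (case x of (m, \<pi>) \<Rightarrow> (\<pi> + staircase r m, m)) of
        (\<pi>, m) \<Rightarrow> (- 1) ^ t m * q ^ sum_mset \<pi>)"
    by (simp add: fun_eq_iff power_t sum_mset_staircase[folded t_def] power_add)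
  finally have "((\<lambda>(\<pi>, m). (- 1) ^ t m * q ^ sum_mset \<pi>) has_sum L * inverse (euler_f q 1))
      (Sigma positive_parts (\<lambda>\<pi>. {..<mex r \<pi>}))"
    unfolding has_sum_reindex_bij_betw[OF staircase_bij[OF assms(1)]] .
  \<comment> \<open>For fixed \<open>\<pi>\<close> only the finitely many \<open>m\<close> below the
    mex remain, and their signs add up to the character value.\<close>
  then have "((\<lambda>\<pi>. mod4_weight (mex r \<pi>) * q ^ sum_mset \<pi>) has_sum L * inverse (euler_f q 1)) positive_parts"
  proof (rule has_sum_SigmaD)
    fix \<pi>
    show "((\<lambda>m. case (\<pi>, m) of (\<pi>, m) \<Rightarrow> (- 1) ^ t m * q ^ sum_mset \<pi>) has_sum
        mod4_weight (mex r \<pi>) * q ^ sum_mset \<pi>) {..<mex r \<pi>}"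
      by (intro has_sum_finiteI) (simp_all add: t_def sum_distrib_right mod4_weight_eq_sum[symmetric])
  qed
  \<comment> \<open>Partitions are now grouped by size; each group is finite and contributes one
    coefficient of the power series.\<close>
  moreover have "bij_betw snd (Sigma UNIV partitions) positive_parts"
    by (rule bij_betw_byWitness[where f' = "\<lambda>\<pi>. (sum_mset \<pi>, \<pi>)"])
       (auto simp: partitions_def positive_parts_def)
  ultimately have "((\<lambda>x. mod4_weight (mex r (snd x)) * q ^ sum_mset (snd x)) has_sum
      L * inverse (euler_f q 1)) (Sigma UNIV partitions)"
    by (subst has_sum_reindex_bij_betw)
  then have "((\<lambda>n. (of_nat (o1 r n) - of_nat (o3 r n)) * q ^ n) has_sum
      L * inverse (euler_f q 1)) UNIV"
  proof (rule has_sum_SigmaD)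
    fix n
    have "(\<Sum>\<pi>\<in>partitions n. mod4_weight (mex r \<pi>) * q ^ sum_mset \<pi>) =
        (\<Sum>\<pi>\<in>partitions n. mod4_weight (mex r \<pi>)) * q ^ n"
      unfolding sum_distrib_right by (intro sum.cong) (auto simp: partitions_def)
    then show "((\<lambda>\<pi>. mod4_weight (mex r (snd (n, \<pi>))) * q ^ sum_mset (snd (n, \<pi>))) has_sum
        (of_nat (o1 r n) - of_nat (o3 r n)) * q ^ n) (partitions n)"
      using finite_partitions by (intro has_sum_finiteI) (simp_all add: o1_minus_o3)
  qed
  moreover have "L * inverse (euler_f q 1) =
      euler_f q r * euler_f q (4 * r) / (euler_f q 1 * euler_f q (2 * r))"
    by (simp add: L_def euler_a divide_simps)
  ultimately show ?thesis
    using has_sum_imp_sums by metis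
qed

end
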